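(* Suppose $\mathcal{Q}$ is a Glivenko--Cantelli--Donsker (GCD) class of measures and $X,\{X_n\}_{n\in\mathbb{N}}$ are iid under each $Q\in\mathcal{Q}$. Let $(k_N)_{N\in\mathbb{N}}$ be a sequence of positive reals with $k_N=o(N)$. Then the nonlinear expectation with $\gamma=\infty$ is a uniformly consistent estimator, that is, for all $P\in\mathcal{Q}$, $$\sup_{\phi:|\phi|\le 1}\Big\{\mathcal{E}^{k_N,\infty}_{\mathcal{Q}|\mathbf{x}_N}(\phi(X))-E_P[\phi(X)]\Big\}\to 0\quad\text{in }P\text{-probability as }N\to\infty,$$ where the supremum is over measurable functions $\phi:\mathbb{R}\to\mathbb{R}$ with $|\phi|\le1$.
   Context: Setting. $\mathcal{Q}$ is a family of probability measures on a measurable space carrying real random variables $X,X_1,X_2,\dots$; under each $Q\in\mathcal{Q}$ the variables $X,\{X_n\}_{n\in\mathbb{N}}$ are iid with density $f(\cdot;Q)$ with respect to Lebesgue measure. Write $\mathbf{x}_N=(X_1,\dots,X_N)$ and $L(Q|\mathbf{x}_N)=\prod_{n=1}^N f(X_n;Q)$. It is assumed that the $\mathcal{Q}$-MLE $\hat Q_N$ exists, i.e. there is a measurable map $\mathbf{x}_N\mapsto\hat Q_N\in\mathcal{Q}$ with $L(\hat Q_N|\mathbf{x}_N)\ge L(Q|\mathbf{x}_N)$ for all $Q\in\mathcal{Q}$. Divergence: $\alpha_{\mathcal{Q}|\mathbf{x}_N}(Q)=-\log L(Q|\mathbf{x}_N)+\sup_{\tilde Q\in\mathcal{Q}}\log L(\tilde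 Q|\mathbf{x}_N)$. DR-expectation with $\gamma=\infty$: for $k>0$, $\mathcal{E}^{k,\infty}_{\mathcal{Q}|\mathbf{x}_N}(\xi)=\sup_{Q\in\mathcal{Q}}\{E_Q[\xi|\mathbf{x}_N]-(\frac1k\alpha_{\mathcal{Q}|\mathbf{x}_N}(Q))^\infty\}$ with the convention $x^\infty=0$ for $x\in[0,1]$ and $x^\infty=+\infty$ for $x>1$; that is, the supremum of $E_Q[\xi|\mathbf{x}_N]$ over $Q\in\mathcal{Q}$ with $\alpha_{\mathcal{Q}|\mathbf{x}_N}(Q)\le k$. For $\xi=\phi(X)$, $E_Q[\xi|\mathbf{x}_N]=E_Q[\phi(X)]$ by independence. Relative entropy of the law of $X$: $D_{\mathrm{KL}|X}(P||Q)=\int\log\big(\frac{f(x;P)}{f(x;Q)}\big)f(x;P)\,dx$. $O_P$ notation: $Y_N=O_P(g(N))$ means $\lim_{M\to\infty}\limsup_{N\to\infty}P(|Y_N/g(N)|>M)=0$. GCD class: $\mathcal{Q}$ is a GCD class if, for any $P\in\mathcal{Q}$, $$\sup^*_{Q\in\mathcal{Q}}\Big|\frac{\alpha_{\mathcal{Q}|\mathbf{x}_N}(Q)}{N}-D_{\mathrm{KL}|X}(P||Q)\Big|=O_P(N^{-1/2}),$$ where $\sup^*$ is the minimal measurable envelope of the supremum. If the supremum over $\phi$ in the claim is not measurable, convergence is understood in the same (minimal measurable envelope) sense. *)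

theory Defs
  imports "HOL-Probability.Probability" "HOL-Library.Landau_Symbols"
begin

section \<open>Minimal measurable envelopes\<close>

definition is_measurable_cover ::
    "'a measure \<Rightarrow> ('a \<Rightarrow> ereal) \<Rightarrow> ('a \<Rightarrow> ereal) \<Rightarrow> bool" where
  "is_measurable_cover P h H \<longleftrightarrow>
     H \<in> borel_measurable P \<and> (\<forall>\<omega>\<in>space P. h \<omega> \<le> H \<omega>) \<and>
     (\<forall>G\<in>borel_measurable P. (AE \<omega> in P. h \<omega> \<le> G \<omega>) \<longrightarrow> (AE \<omega> in P. H \<omega> \<le> G \<omega>))"

text \<open>The choice below is well defined up to \<open>P\<close>-null sets: existence is lemma
  \<open>is_measurable_cover_measurable_cover\<close>, uniqueness lemma \<open>is_measurable_cover_unique\<close>.\<close>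

definition measurable_cover :: "'a measure \<Rightarrow> ('a \<Rightarrow> ereal) \<Rightarrow> 'a \<Rightarrow> ereal" where
  "measurable_cover P h = (SOME H. is_measurable_cover P h H)"

lemma is_measurable_cover_unique:
  assumes "is_measurable_cover P h H" "is_measurable_cover P h G"
  shows "AE \<omega> in P. H \<omega> = G \<omega>"
proof -
  have "AE \<omega> in P. H \<omega> \<le> G \<omega>" "AE \<omega> in P. G \<omega> \<le> H \<omega>"
    using assms by (auto simp: is_measurable_cover_def)
  then show ?thesis by eventually_elim auto
qed

lemma is_measurable_cover_exists:
  assumes "prob_space P"
  shows "\<exists>H. is_measurable_cover P h H"
proof -
  interpret prob_space P by fact
  define g :: "ereal \<Rightarrow> real" where
    "g x = (if x = \<infinity> then 2 else if x = -\<infinity> then -2 else arctan (real_of_ereal x))" for x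
  have g_meas [measurable]: "g \<in> borel_measurable borel"
    unfolding g_def by measurable
  have arctan_b: "\<bar>arctan y\<bar> < 2" for y
    using arctan_bounded[of y] pi_less_4 by linarith
  have g_strict: "g x < g y" if "x < y" for x y
    using that arctan_b[of "real_of_ereal x"] arctan_b[of "real_of_ereal y"]
    by (cases x; cases y) (simp_all add: g_def arctan_less_iff abs_less_iff)
  have g_mono: "g x \<le> g y" if "x \<le> y" for x y
    using g_strict[of x y] that by (cases "x = y") (simp, meson less_le less_imp_le order.order_iff_strict)
  have g_bd: "\<bar>g x\<bar> \<le> 2" for x
    unfolding g_def using arctan_b by (auto simp: less_imp_le)
  have g_int: "integrable P (\<lambda>\<omega>. g (G \<omega>))" if [measurable]: "G \<in> borel_measurable P" for G
    by (rule integrable_const_bound[where B = 2]) (use g_bd in auto)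
  define A where "A = {G \<in> borel_measurable P. \<forall>\<omega>\<in>space P. h \<omega> \<le> G \<omega>}"
  define J where "J G = (\<integral>\<omega>. g (G \<omega>) \<partial>P)" for G
  have top: "(\<lambda>_. \<infinity>) \<in> A" by (auto simp: A_def)
  have g_lb: "-2 \<le> g x" for x
    using g_bd[of x] by linarith
  have J_lb: "-2 \<le> J G" if "G \<in> A" for G
  proof -
    have "(\<integral>\<omega>. -2 \<partial>P) \<le> J G"
      unfolding J_def using that g_lb
      by (intro integral_mono g_int) (auto simp: A_def)
    then show ?thesis by (simp add: prob_space)
  qed
  have bdd: "bdd_below (J ` A)" using J_lb by (auto intro!: bdd_belowI2)
  define c where "c = (INF G\<in>A. J G)"
  have "\<exists>G\<in>A. J G < c + 1 / real (Suc n)" for n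
    using cINF_less_iff[of A J "c + 1 / real (Suc n)"] bdd top by (auto simp: c_def)
  then obtain F where F: "\<And>n. F n \<in> A" "\<And>n. J (F n) < c + 1 / real (Suc n)" by metis
  define H where "H \<omega> = (INF n. F n \<omega>)" for \<omega>
  have F_meas [measurable]: "F n \<in> borel_measurable P" for n using F(1) by (auto simp: A_def)
  have H_meas [measurable]: "H \<in> borel_measurable P" unfolding H_def by measurable
  have HA: "H \<in> A" using F(1) H_meas by (auto simp: A_def H_def intro!: INF_greatest)
  have JH: "J H \<le> c"
  proof (rule field_le_epsilon)
    fix e :: real assume "0 < e"
    then obtain n where n: "1 / real (Suc n) < e" using nat_approx_posE by metis
    have "J H \<le> J (F n)" unfolding J_def
      by (intro integral_mono g_int g_mono) (auto simp: H_def intro: INF_lower)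
    also note F(2)[of n]
    finally show "J H \<le> c + e" using n by simp
  qed
  have min: "AE \<omega> in P. H \<omega> \<le> G \<omega>" if GA: "G \<in> A" for G
  proof -
    have [measurable]: "G \<in> borel_measurable P" using GA by (auto simp: A_def)
    define K where "K \<omega> = min (H \<omega>) (G \<omega>)" for \<omega>
    have K_meas [measurable]: "K \<in> borel_measurable P" unfolding K_def by measurable
    have "K \<in> A" using HA GA K_meas by (auto simp: A_def K_def)
    then have "c \<le> J K" unfolding c_def by (intro cINF_lower bdd)
    moreover have "J K \<le> J H" unfolding J_def
      by (intro integral_mono g_int g_mono) (auto simp: K_def)
    ultimately have "J H = J K" using JH by simp
    then have "(\<integral>\<omega>. g (H \<omega>) - g (K \<omega>) \<partial>P) = 0"
      by (simp add: J_def Bochner_Integration.integral_diff g_int)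
    moreover have nonneg: "0 \<le> g (H \<omega>) - g (K \<omega>)" for \<omega>
      using g_mono[of "K \<omega>" "H \<omega>"] by (simp add: K_def)
    ultimately have "AE \<omega> in P. g (H \<omega>) - g (K \<omega>) = 0"
      by (subst (asm) integral_nonneg_eq_0_iff_AE)
         (auto intro!: Bochner_Integration.integrable_diff g_int)
    then show ?thesis
    proof eventually_elim
      fix \<omega> assume *: "g (H \<omega>) - g (K \<omega>) = 0"
      show "H \<omega> \<le> G \<omega>"
        using g_strict[of "K \<omega>" "H \<omega>"] * by (cases "H \<omega> \<le> G \<omega>") (auto simp: K_def min_def not_le)
    qed
  qed
  have "is_measurable_cover P h H"
    unfolding is_measurable_cover_def
  proof (intro conjI ballI impI)
    show "H \<in> borel_measurable P" by fact
    show "h \<omega> \<le> H \<omega>" if "\<omega> \<in> space P" for \<omega> using HA that by (auto simp: A_def)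
    fix G :: "'a \<Rightarrow> ereal"
    assume [measurable]: "G \<in> borel_measurable P" and ae: "AE \<omega> in P. h \<omega> \<le> G \<omega>"
    from ae obtain N where N: "{\<omega>\<in>space P. \<not> h \<omega> \<le> G \<omega>} \<subseteq> N" "N \<in> null_sets P"
      by (auto elim!: AE_E)
    then have [measurable]: "N \<in> sets P" by auto
    define G' where "G' \<omega> = (if \<omega> \<in> N then \<infinity> else G \<omega>)" for \<omega>
    have "G' \<in> borel_measurable P" unfolding G'_def by measurable
    then have "G' \<in> A" using N(1) by (auto simp: A_def G'_def)
    from min[OF this] AE_not_in[OF N(2)] show "AE \<omega> in P. H \<omega> \<le> G \<omega>"
      by eventually_elim (auto simp: G'_def)
  qed
  then show ?thesis by blast
qed

lemma is_measurable_cover_measurable_cover: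
  "prob_space P \<Longrightarrow> is_measurable_cover P h (measurable_cover P h)"
  unfolding measurable_cover_def by (rule someI_ex[OF is_measurable_cover_exists])


section \<open>Stochastic convergence of extended real random variables\<close>

definition bigO_in_prob :: "'a measure \<Rightarrow> (nat \<Rightarrow> 'a \<Rightarrow> ereal) \<Rightarrow> (nat \<Rightarrow> real) \<Rightarrow> bool" where
  "bigO_in_prob P Y g \<longleftrightarrow>
     ((\<lambda>C::real. limsup (\<lambda>N. emeasure P {\<omega>\<in>space P. \<bar>Y N \<omega> / ereal (g N)\<bar> > ereal C}))
        \<longlongrightarrow> 0) at_top"

definition tendsto_0_in_prob :: "'a measure \<Rightarrow> (nat \<Rightarrow> 'a \<Rightarrow> ereal) \<Rightarrow> bool" where
  "tendsto_0_in_prob P Y \<longleftrightarrow>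
     (\<forall>\<epsilon>>0. (\<lambda>N. measure P {\<omega>\<in>space P. \<bar>Y N \<omega>\<bar> > ereal \<epsilon>}) \<longlonglongrightarrow> 0)"


section \<open>Likelihood, divergence and relative entropy\<close>

text \<open>Likelihoods and densities may vanish, so the real \<open>ln\<close>, for which \<open>ln 0 = 0\<close>, cannot
  be used.\<close>

definition eln :: "ereal \<Rightarrow> ereal" where
  "eln x = (if x \<le> 0 then -\<infinity> else if x = \<infinity> then \<infinity> else ereal (ln (real_of_ereal x)))"

text \<open>Throughout, \<open>f Q\<close> is the density under the measure \<open>Q\<close>, and a sample is a sequence
  \<open>x\<close> of which only the entries \<open>x 1, \<dots>, x N\<close> are used.\<close>

definition likelihood :: "('q \<Rightarrow> real \<Rightarrow> real) \<Rightarrow> nat \<Rightarrow> (nat \<Rightarrow> real) \<Rightarrow> 'q \<Rightarrow> real" where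
  "likelihood f N x Q = (\<Prod>n=1..N. f Q (x n))"

definition divergence ::
    "('q \<Rightarrow> real \<Rightarrow> real) \<Rightarrow> 'q set \<Rightarrow> nat \<Rightarrow> (nat \<Rightarrow> real) \<Rightarrow> 'q \<Rightarrow> ereal" where
  "divergence f \<Q> N x Q =
     - eln (ereal (likelihood f N x Q)) + (SUP Q'\<in>\<Q>. eln (ereal (likelihood f N x Q')))"

text \<open>The integral of \<open>log (p / q) * p\<close> as an extended real, i.e. the difference of the integrals
  of the positive and the negative part; for densities the latter is at most 1. The arithmetic of
  \<^typ>\<open>ereal\<close> makes the integrand \<open>0\<close> where \<open>p = 0\<close> and \<open>\<infinity>\<close> where \<open>q = 0 < p\<close>.\<close>

definition rel_entropy :: "(real \<Rightarrow> real) \<Rightarrow> (real \<Rightarrow> real) \<Rightarrow> ereal" where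
  "rel_entropy p q =
     enn2ereal (\<integral>\<^sup>+x. e2ennreal (eln (ereal (p x) / ereal (q x)) * ereal (p x)) \<partial>lborel)
   - enn2ereal (\<integral>\<^sup>+x. e2ennreal (- (eln (ereal (p x) / ereal (q x)) * ereal (p x))) \<partial>lborel)"

lemma eln_ratio_mult:
  assumes "0 \<le> p" "0 \<le> q"
  shows "eln (ereal p / ereal q) * ereal p =
    (if p = 0 then 0 else if q = 0 then \<infinity> else ereal (ln (p / q) * p))"
  using assms by (auto simp: eln_def divide_ereal_def ereal_mult_infty zero_ereal_def divide_simps)

lemma rel_entropy_eq_KL_divergence:
  assumes [measurable]: "p \<in> borel_measurable borel" "q \<in> borel_measurable borel"
    and nonneg: "\<And>x. 0 \<le> p x" "\<And>x. 0 \<le> q x"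
    and ac: "AE x in lborel. q x = 0 \<longrightarrow> p x = 0"
    and int: "integrable lborel (\<lambda>x. ln (p x / q x) * p x)"
  shows "rel_entropy p q =
    ereal (KL_divergence (exp 1) (density lborel (\<lambda>x. ennreal (q x))) (density lborel (\<lambda>x. ennreal (p x))))"
proof -
  let ?g = "\<lambda>x. ln (p x / q x) * p x"
  have e2e: "e2ennreal (ereal r) = ennreal r" for r
  proof (cases "0 \<le> r")
    case True
    then have "ereal r = enn2ereal (ennreal r)" by (simp add: enn2ereal_ennreal)
    then show ?thesis by simp
  qed (simp add: ennreal_neg e2ennreal_neg)
  have eq: "AE x in lborel. eln (ereal (p x) / ereal (q x)) * ereal (p x) = ereal (?g x)"
    using ac by eventually_elim (simp only: eln_ratio_mult nonneg, auto)
  have 1: "(\<integral>\<^sup>+x. e2ennreal (eln (ereal (p x) / ereal (q x)) * ereal (p x)) \<partial>lborel)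
      = (\<integral>\<^sup>+x. ennreal (?g x) \<partial>lborel)"
    by (rule nn_integral_cong_AE) (use eq in eventually_elim, simp add: e2e)
  have 2: "(\<integral>\<^sup>+x. e2ennreal (- (eln (ereal (p x) / ereal (q x)) * ereal (p x))) \<partial>lborel)
      = (\<integral>\<^sup>+x. ennreal (- ?g x) \<partial>lborel)"
    by (rule nn_integral_cong_AE) (use eq in eventually_elim, simp add: e2e)
  obtain a b where ab: "0 \<le> a" "0 \<le> b" "(\<integral>\<^sup>+x. ennreal (?g x) \<partial>lborel) = ennreal a"
     "(\<integral>\<^sup>+x. ennreal (- ?g x) \<partial>lborel) = ennreal b" "(\<integral>x. ?g x \<partial>lborel) = a - b"
    by (rule integrableE[OF int]) (rule that)
  have "rel_entropy p q = ereal (\<integral>x. ?g x \<partial>lborel)"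
    unfolding rel_entropy_def 1 2 ab(3,4,5) using ab(1,2) by (simp add: enn2ereal_ennreal)
  also have "(\<integral>x. ?g x \<partial>lborel) = (\<integral>x. p x * log (exp 1) (p x / q x) \<partial>lborel)"
    by (simp add: log_def mult.commute)
  also have "\<dots> = KL_divergence (exp 1) (density lborel (\<lambda>x. ennreal (q x)))
      (density lborel (\<lambda>x. ennreal (p x)))"
    by (rule lborel.KL_density_density[symmetric]) (use nonneg ac in auto)
  finally show ?thesis .
qed


section \<open>Divergence-robust expectation with infinite exponent\<close>

text \<open>\<open>x \<mapsto> x\<^sup>\<gamma>\<close> for \<open>\<gamma> = \<infinity>\<close>, with the convention \<open>x\<^sup>\<infinity> = 0\<close> on \<open>[0,1]\<close>.\<close>

definition pow_infty :: "ereal \<Rightarrow> ereal" where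
  "pow_infty x = (if x \<le> 1 then 0 else \<infinity>)"

text \<open>The value at \<open>\<phi>(X)\<close>; as \<open>X\<close> is independent of the sample, the conditional expectation of
  \<open>\<phi>(X)\<close> given the sample is \<open>E\<^sub>Q[\<phi>(X)]\<close>.\<close>

definition DR_expectation ::
    "('a measure \<Rightarrow> real \<Rightarrow> real) \<Rightarrow> 'a measure set \<Rightarrow> ('a \<Rightarrow> real) \<Rightarrow> nat \<Rightarrow> (nat \<Rightarrow> real) \<Rightarrow>
     real \<Rightarrow> (real \<Rightarrow> real) \<Rightarrow> ereal" where
  "DR_expectation f \<Q> X N x k \<phi> =
     (SUP Q\<in>\<Q>. ereal (\<integral>\<omega>. \<phi> (X \<omega>) \<partial>Q) - pow_infty (ereal (1 / k) * divergence f \<Q> N x Q))"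


section \<open>Statistical model\<close>

text \<open>\<open>Xs n\<close> for \<open>n \<ge> 1\<close> are the observations; the unused index \<open>0\<close> is overwritten by \<open>X\<close>
  to make \<open>X, X\<^sub>1, X\<^sub>2, \<dots>\<close> a single family.\<close>

definition iid_model ::
    "'a measure \<Rightarrow> 'a measure set \<Rightarrow> ('a \<Rightarrow> real) \<Rightarrow> (nat \<Rightarrow> 'a \<Rightarrow> real) \<Rightarrow>
     ('a measure \<Rightarrow> real \<Rightarrow> real) \<Rightarrow> bool" where
  "iid_model M \<Q> X Xs f \<longleftrightarrow>
     (\<forall>Q\<in>\<Q>. prob_space Q \<and> sets Q = sets M \<and>
        prob_space.indep_vars Q (\<lambda>_. borel) (Xs(0 := X)) UNIV \<and>
        (\<forall>x. 0 \<le> f Q x) \<and>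
        (\<forall>n. distributed Q lborel ((Xs(0 := X)) n) (\<lambda>x. ennreal (f Q x))))"

text \<open>\<open>S\<close> carries the \<open>\<sigma>\<close>-algebra on \<open>\<Q>\<close> for which the estimator is measurable.\<close>

definition MLE_exists ::
    "'a measure \<Rightarrow> 'a measure measure \<Rightarrow> 'a measure set \<Rightarrow> (nat \<Rightarrow> 'a \<Rightarrow> real) \<Rightarrow>
     ('a measure \<Rightarrow> real \<Rightarrow> real) \<Rightarrow> nat \<Rightarrow> bool" where
  "MLE_exists M S \<Q> Xs f N \<longleftrightarrow>
     (\<exists>Qhat \<in> (\<Pi>\<^sub>M n\<in>{1..N}. borel) \<rightarrow>\<^sub>M S.
        \<forall>\<omega>\<in>space M. let x = (\<lambda>n\<in>{1..N}. Xs n \<omega>) in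
          Qhat x \<in> \<Q> \<and> (\<forall>Q\<in>\<Q>. likelihood f N x Q \<le> likelihood f N x (Qhat x)))"

text \<open>If both the divergence and the relative entropy are infinite, they are taken to agree
  (the difference \<open>\<infinity> - \<infinity>\<close> of \<^typ>\<open>ereal\<close> would be \<open>\<infinity>\<close>).\<close>

definition entropy_gap ::
    "('a measure \<Rightarrow> real \<Rightarrow> real) \<Rightarrow> 'a measure set \<Rightarrow> 'a measure \<Rightarrow> nat \<Rightarrow> (nat \<Rightarrow> real) \<Rightarrow>
     'a measure \<Rightarrow> ereal" where
  "entropy_gap f \<Q> P N x Q =
     (let a = divergence f \<Q> N x Q / ereal (real N); d = rel_entropy (f P) (f Q)
      in if a = \<infinity> \<and> d = \<infinity> then 0 else \<bar>a - d\<bar>)"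

definition GCD_class ::
    "'a measure set \<Rightarrow> (nat \<Rightarrow> 'a \<Rightarrow> real) \<Rightarrow> ('a measure \<Rightarrow> real \<Rightarrow> real) \<Rightarrow> bool" where
  "GCD_class \<Q> Xs f \<longleftrightarrow>
     (\<forall>P\<in>\<Q>. bigO_in_prob P
        (\<lambda>N. measurable_cover P (\<lambda>\<omega>. SUP Q\<in>\<Q>. entropy_gap f \<Q> P N (\<lambda>n. Xs n \<omega>) Q))
        (\<lambda>N. real N powr (-1/2)))"

end

theory Submission
  imports Defs
begin

text \<open>On the event that the GCD supremum is at most \<open>C / sqrt N\<close>, every \<open>Q\<close> with divergence at most
  \<open>k\<^sub>N\<close> has relative entropy at most \<open>k\<^sub>N / N + C / sqrt N \<rightarrow> 0\<close> from \<open>P\<close>, so by a Pinsker-type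
  inequality the laws of \<open>X\<close> under \<open>P\<close> and \<open>Q\<close> are uniformly close in total variation. In the other
  direction the supremum is almost surely nonnegative: take \<open>\<phi> = 0\<close> and observe that the maximum
  likelihood estimator has divergence \<open>0\<close> as soon as the likelihood of \<open>P\<close> does not vanish.\<close>

section \<open>A Pinsker-type inequality\<close>

text \<open>Apply \<open>ln z \<le> z - 1\<close> at \<open>z = sqrt q / sqrt p\<close> and multiply
  by \<open>p\<close>. Integrated over two densities this bounds the squared Hellinger distance by
  the relative entropy; the terms \<open>- p + q\<close> then cancel but keep the right side
  nonnegative pointwise.\<close>

lemma ln_ratio_mult_ge:
  fixes p q :: real
  assumes "0 < p" "0 < q"
  shows "(sqrt p - sqrt q)\<^sup>2 \<le> ln (p / q) * p - p + q"
proof -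
  have "ln (sqrt q / sqrt p) \<le> sqrt q / sqrt p - 1"
    using assms by (intro ln_le_minus_one) auto
  moreover have "ln (sqrt q / sqrt p) = - (ln (p / q) / 2)"
    using assms by (simp add: ln_div ln_sqrt field_simps)
  ultimately have "p * (1 - sqrt q / sqrt p) \<le> p * (ln (p / q) / 2)"
    using assms by (intro mult_left_mono) auto
  moreover have "p * (sqrt q / sqrt p) = sqrt p * sqrt q"
    using assms by (metis less_eq_real_def real_div_sqrt times_divide_eq_left times_divide_eq_right)
  ultimately have "p - sqrt p * sqrt q \<le> ln (p / q) * p / 2"
    by (simp only: right_diff_distrib mult_1_right) (simp add: mult.commute)
  then show ?thesis
    using assms by (simp add: power2_eq_square algebra_simps)
qed

text \<open>Factor \<open>p - q\<close> into difference and sum of square roots and apply the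
  weighted AM-GM inequality. The free weight \<open>t\<close> stands in for Cauchy-Schwarz: the
  bound stays additive under integration, and \<open>t\<close> is optimized afterwards.\<close>

lemma abs_diff_le_sqrt_diff_square:
  fixes p q t :: real
  assumes "0 \<le> p" "0 \<le> q" "0 < t"
  shows "\<bar>p - q\<bar> \<le> t / 2 * (sqrt p - sqrt q)\<^sup>2 + (p + q) / t"
proof -
  define a b where "a = \<bar>sqrt p - sqrt q\<bar>" and "b = sqrt p + sqrt q"
  have "p - q = (sqrt p - sqrt q) * (sqrt p + sqrt q)"
    using assms by (simp add: algebra_simps)
  then have ab: "\<bar>p - q\<bar> = a * b"
    using assms by (simp add: abs_mult a_def b_def)
  \<comment> \<open>AM-GM for \<open>t * a\<close> and \<open>b\<close>.\<close>
  have "0 \<le> (t * a - b)\<^sup>2" by simp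
  then have "2 * (a * b) * t \<le> t\<^sup>2 * a\<^sup>2 + b\<^sup>2"
    by (simp add: power2_eq_square algebra_simps)
  then have "a * b \<le> t / 2 * a\<^sup>2 + b\<^sup>2 / (2 * t)"
    using assms by (simp add: field_simps power2_eq_square)
  moreover have "b\<^sup>2 \<le> 2 * (p + q)"
  proof -
    have "0 \<le> (sqrt p - sqrt q)\<^sup>2" by simp
    then show ?thesis using assms by (simp add: b_def power2_eq_square algebra_simps)
  qed
  then have "b\<^sup>2 / (2 * t) \<le> (p + q) / t"
    using assms by (simp add: field_simps)
  moreover have "a\<^sup>2 = (sqrt p - sqrt q)\<^sup>2" by (simp add: a_def)
  ultimately show ?thesis using ab by simp
qed

section \<open>Positive and negative parts of the relative entropy integrand\<close>

lemma e2ennreal_ereal: "e2ennreal (ereal r) = ennreal r"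
proof (cases "0 \<le> r")
  case True
  then have "ereal r = enn2ereal (ennreal r)" by (simp add: enn2ereal_ennreal)
  then show ?thesis by simp
qed (simp add: ennreal_neg e2ennreal_neg)

lemma pos_part_eln_ratio:
  assumes "0 \<le> p" "0 \<le> q"
  shows "e2ennreal (eln (ereal p / ereal q) * ereal p) =
    (if p = 0 then 0 else if q = 0 then \<infinity> else ennreal (ln (p / q) * p))"
  unfolding eln_ratio_mult[OF assms] by (auto simp: e2ennreal_ereal e2ennreal_infty)

lemma neg_part_eln_ratio:
  assumes "0 \<le> p" "0 \<le> q"
  shows "e2ennreal (- (eln (ereal p / ereal q) * ereal p)) =
    (if p = 0 \<or> q = 0 then 0 else ennreal (- (ln (p / q) * p)))"
  unfolding eln_ratio_mult[OF assms]
  by (auto simp: e2ennreal_ereal e2ennreal_neg)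

text \<open>Dropping the square in \<open>ln_ratio_mult_ge\<close> leaves
  \<open>- ln (p / q) * p \<le> q - p\<close>. Hence the negative part has integral at most 1 for
  densities, and \<open>rel_entropy\<close> is never a difference of two infinities.\<close>

lemma neg_part_eln_ratio_le:
  assumes "0 \<le> p" "0 \<le> q"
  shows "e2ennreal (- (eln (ereal p / ereal q) * ereal p)) \<le> ennreal q"
proof (cases "p = 0 \<or> q = 0")
  case False
  then have "0 \<le> ln (p / q) * p - p + q"
    using ln_ratio_mult_ge[of p q] assms zero_le_power2[of "sqrt p - sqrt q"] by linarith
  then show ?thesis
    unfolding neg_part_eln_ratio[OF assms] using assms by (auto intro!: ennreal_leI)
qed (simp only: neg_part_eln_ratio[OF assms] if_True zero_le)

text \<open>Written without subtraction, so that it can be integrated in \<^typ>\<open>ennreal\<close>.\<close>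

lemma abs_diff_le_eln_ratio:
  fixes p q t :: real
  assumes "0 \<le> p" "0 \<le> q" "0 < t"
  shows "ennreal \<bar>p - q\<bar> + ennreal (t / 2) * e2ennreal (- (eln (ereal p / ereal q) * ereal p))
      + ennreal (t / 2) * ennreal p
    \<le> ennreal (t / 2) * e2ennreal (eln (ereal p / ereal q) * ereal p)
      + ennreal (t / 2) * ennreal q + ennreal (1 / t) * (ennreal p + ennreal q)"
    (is "?L \<le> ?R")
proof -
  note bound = abs_diff_le_sqrt_diff_square[OF assms]
  consider "p = 0" | "p > 0" "q = 0" | "p > 0" "q > 0"
    using assms by linarith
  then show ?thesis
  proof cases
    case 1
    then have "\<bar>p - q\<bar> \<le> t / 2 * q + 1 / t * q"
      using bound assms by simp
    then have "ennreal \<bar>p - q\<bar> \<le> ennreal (t / 2) * ennreal q + ennreal (1 / t) * ennreal q"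
      using assms by (simp flip: ennreal_mult ennreal_plus add: ennreal_leI)
    then show ?thesis
      using 1 assms(2) unfolding pos_part_eln_ratio[OF assms(1,2)] neg_part_eln_ratio[OF assms(1,2)]
      by simp
  next
    case 2
    \<comment> \<open>The positive part is infinite here, and its factor \<open>t / 2\<close> is
      positive.\<close>
    then have "?R = \<infinity>"
      using assms unfolding pos_part_eln_ratio[OF assms(1,2)] by (simp add: ennreal_mult_top)
    then show ?thesis by (simp only: infinity_ennreal_def top_greatest)
  next
    case 3
    define u where "u = ln (p / q) * p"
    have "t / 2 * (sqrt p - sqrt q)\<^sup>2 \<le> t / 2 * (u - p + q)"
      unfolding u_def using ln_ratio_mult_ge[OF 3] assms by (intro mult_left_mono) auto
    \<comment> \<open>Splitting \<open>u\<close> into its parts lets the negative one move to the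
      left side, so that both sides become sums of nonnegative terms.\<close>
    moreover have "t / 2 * u = t / 2 * max 0 u - t / 2 * max 0 (- u)"
      by (simp add: max_def)
    moreover have "t / 2 * (u - p + q) = t / 2 * u - t / 2 * p + t / 2 * q"
      by (simp only: distrib_left right_diff_distrib)
    moreover have "1 / t * (p + q) = (p + q) / t" by simp
    ultimately have "\<bar>p - q\<bar> + t / 2 * max 0 (- u) + t / 2 * p
        \<le> t / 2 * max 0 u + t / 2 * q + 1 / t * (p + q)"
      using bound by linarith
    then have "ennreal \<bar>p - q\<bar> + ennreal (t / 2) * ennreal (max 0 (- u))
        + ennreal (t / 2) * ennreal p
      \<le> ennreal (t / 2) * ennreal (max 0 u) + ennreal (t / 2) * ennreal q
        + ennreal (1 / t) * (ennreal p + ennreal q)"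
      using assms by (simp flip: ennreal_mult ennreal_plus add: ennreal_leI del: ennreal_max_0 ennreal_max_0')
    moreover have "ennreal (max 0 v) = ennreal v" for v
      by (simp add: max_def ennreal_neg)
    ultimately show ?thesis
      using 3 unfolding pos_part_eln_ratio[OF assms(1,2)] neg_part_eln_ratio[OF assms(1,2)] u_def
      by simp
  qed
qed

text \<open>Integrate \<open>abs_diff_le_eln_ratio\<close>: both densities have mass 1, so the terms
  \<open>t / 2 * p\<close> and \<open>t / 2 * q\<close> cancel and \<open>t / 2 * d + 2 / t\<close>
  remains. The resulting constant is weaker than Pinsker's \<open>sqrt (2 * d)\<close>, but any
  bound vanishing with \<open>d\<close> suffices.\<close>

lemma nn_integral_abs_diff_le_rel_entropy:
  assumes [measurable]: "p \<in> borel_measurable borel" "q \<in> borel_measurable borel"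
    and nonneg: "\<And>x. 0 \<le> p x" "\<And>x. 0 \<le> q x"
    and p1: "(\<integral>\<^sup>+x. ennreal (p x) \<partial>lborel) = 1"
    and q1: "(\<integral>\<^sup>+x. ennreal (q x) \<partial>lborel) = 1"
    and D: "rel_entropy p q \<le> ereal d" and "0 < d"
  shows "(\<integral>\<^sup>+x. ennreal \<bar>p x - q x\<bar> \<partial>lborel) \<le> ennreal (2 * sqrt d)"
proof -
  define pos where "pos x = e2ennreal (eln (ereal (p x) / ereal (q x)) * ereal (p x))" for x
  define neg where "neg x = e2ennreal (- (eln (ereal (p x) / ereal (q x)) * ereal (p x)))" for x
  \<comment> \<open>The explicit case forms reduce measurability to that of \<open>p\<close> and
    \<open>q\<close>.\<close>
  have [measurable]: "(\<lambda>x. pos x) \<in> borel_measurable lborel" "(\<lambda>x. neg x) \<in> borel_measurable lborel"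
    unfolding pos_def neg_def pos_part_eln_ratio[OF nonneg] neg_part_eln_ratio[OF nonneg] by measurable
  define A where "A = (\<integral>\<^sup>+x. pos x \<partial>lborel)"
  define B where "B = (\<integral>\<^sup>+x. neg x \<partial>lborel)"
  define I where "I = (\<integral>\<^sup>+x. ennreal \<bar>p x - q x\<bar> \<partial>lborel)"
  \<comment> \<open>This is the minimizer of \<open>t / 2 * d + 2 / t\<close>, with minimum
    \<open>2 * sqrt d\<close>.\<close>
  define t where "t = 2 / sqrt d"
  have t: "0 < t" using \<open>0 < d\<close> by (simp add: t_def)
  have "B \<le> (\<integral>\<^sup>+x. ennreal (q x) \<partial>lborel)"
    unfolding B_def neg_def by (intro nn_integral_mono neg_part_eln_ratio_le nonneg)
  then have "B \<le> 1" using q1 by simp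
  then have "B < \<top>"
    by (rule le_less_trans) simp
  then obtain b where b: "0 \<le> b" "B = ennreal b"
    by (cases B) auto
  have D': "enn2ereal A - enn2ereal B \<le> ereal d"
    using D by (simp add: rel_entropy_def A_def B_def pos_def neg_def)
  \<comment> \<open>As \<open>B\<close> is finite, an infinite \<open>A\<close> would make the
    relative entropy infinite.\<close>
  then have "A \<noteq> \<top>"
    using b by (auto simp: enn2ereal_ennreal)
  then obtain a where a: "0 \<le> a" "A = ennreal a"
    by (cases A) auto
  have ab: "a - b \<le> d"
    using D' a b by (simp add: enn2ereal_ennreal)
  have "(\<integral>\<^sup>+x. ennreal \<bar>p x - q x\<bar> + ennreal (t / 2) * neg x
        + ennreal (t / 2) * ennreal (p x) \<partial>lborel)
      \<le> (\<integral>\<^sup>+x. ennreal (t / 2) * pos x + ennreal (t / 2) * ennreal (q x)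
        + ennreal (1 / t) * (ennreal (p x) + ennreal (q x)) \<partial>lborel)"
    unfolding pos_def neg_def by (intro nn_integral_mono abs_diff_le_eln_ratio nonneg t)
  then have "I + ennreal (t / 2) * B + ennreal (t / 2) * 1
      \<le> ennreal (t / 2) * A + ennreal (t / 2) * 1 + ennreal (1 / t) * (1 + 1)"
    by (simp add: nn_integral_add nn_integral_cmult p1 q1 I_def A_def B_def)
  also have "\<dots> = ennreal (t / 2 * a + t / 2 + 2 / t)"
    using a t by (simp flip: ennreal_mult ennreal_plus ennreal_1 ennreal_numeral)
  finally have le: "I + ennreal (t / 2) * B + ennreal (t / 2) * 1
      \<le> ennreal (t / 2 * a + t / 2 + 2 / t)" .
  \<comment> \<open>All three integrals must be finite before the inequality can be rearranged over
    the reals.\<close>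
  have "I \<le> I + ennreal (t / 2) * B + ennreal (t / 2) * 1"
    by (simp add: add.assoc)
  then have "I < \<top>"
    using le by (metis ennreal_less_top le_less_trans order_trans)
  then obtain i where i: "0 \<le> i" "I = ennreal i"
    by (cases I) auto
  have "ennreal (i + t / 2 * b + t / 2) \<le> ennreal (t / 2 * a + t / 2 + 2 / t)"
    using le t i b by (simp flip: ennreal_mult ennreal_plus)
  then have "i + t / 2 * b + t / 2 \<le> t / 2 * a + t / 2 + 2 / t"
    using a t by (subst (asm) ennreal_le_iff) auto
  then have "i \<le> t / 2 * (a - b) + 2 / t"
    by (simp add: right_diff_distrib)
  also have "\<dots> \<le> t / 2 * d + 2 / t"
    using ab t by (intro add_right_mono mult_left_mono) auto
  also have "\<dots> = 2 * sqrt d"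
    using \<open>0 < d\<close> by (simp add: t_def real_div_sqrt)
  finally show ?thesis
    using i by (simp add: I_def ennreal_leI)
qed

text \<open>The expectations differ by the integral of \<open>(q - p) * \<phi>\<close>, which is at
  most the L1 distance of the densities because \<open>\<phi>\<close> is bounded by 1. The bound is
  therefore uniform in \<open>\<phi>\<close>.\<close>

lemma expectation_diff_le_rel_entropy:
  fixes \<phi> :: "real \<Rightarrow> real"
  assumes prob: "prob_space P" "prob_space Q"
    and dist: "distributed P lborel X (\<lambda>x. ennreal (p x))"
      "distributed Q lborel X (\<lambda>x. ennreal (q x))"
    and nonneg: "\<And>x. 0 \<le> p x" "\<And>x. 0 \<le> q x"
    and D: "rel_entropy p q \<le> ereal d" "0 < d"
    and [measurable]: "\<phi> \<in> borel_measurable borel" and \<phi>: "\<And>y. \<bar>\<phi> y\<bar> \<le> 1"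
  shows "\<bar>(\<integral>\<omega>. \<phi> (X \<omega>) \<partial>Q) - (\<integral>\<omega>. \<phi> (X \<omega>) \<partial>P)\<bar> \<le> 2 * sqrt d"
proof -
  have density: "r \<in> borel_measurable borel \<and> (\<integral>\<^sup>+x. ennreal (r x) \<partial>lborel) = 1
      \<and> integrable lborel (\<lambda>x. r x * \<phi> x) \<and> integrable lborel r"
    if "prob_space R" "distributed R lborel X (\<lambda>x. ennreal (r x))" "\<And>x. 0 \<le> r x" for R r
  proof -
    interpret R: prob_space R by fact
    have [measurable]: "r \<in> borel_measurable borel"
      using distributed_real_measurable[of lborel r R X] that by simp
    have "(\<integral>\<^sup>+x. ennreal (r x) * 1 \<partial>lborel) = (\<integral>\<^sup>+\<omega>. 1 \<partial>R)"
      by (rule distributed_nn_integral[OF that(2)]) simp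
    then have 1: "(\<integral>\<^sup>+x. ennreal (r x) \<partial>lborel) = 1"
      by (simp add: R.emeasure_space_1)
    then have int: "integrable lborel r"
      using that(3) by (intro integrableI_nonneg) auto
    have "integrable lborel (\<lambda>x. r x * \<phi> x)"
    proof (rule Bochner_Integration.integrable_bound[OF int])
      show "AE x in lborel. norm (r x * \<phi> x) \<le> norm (r x)"
        using \<phi> that(3) by (auto simp: abs_mult intro!: mult_left_le)
    qed simp
    with 1 int show ?thesis by simp
  qed
  note dP = density[OF prob(1) dist(1) nonneg(1)] and dQ = density[OF prob(2) dist(2) nonneg(2)]
  have "(\<integral>\<omega>. \<phi> (X \<omega>) \<partial>Q) - (\<integral>\<omega>. \<phi> (X \<omega>) \<partial>P) = (\<integral>x. q x * \<phi> x \<partial>lborel) - (\<integral>x. p x * \<phi> x \<partial>lborel)"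
    using distributed_integral[OF dist(1), of \<phi>] distributed_integral[OF dist(2), of \<phi>] nonneg
    by simp
  also have "\<dots> = (\<integral>x. (q x - p x) * \<phi> x \<partial>lborel)"
    using dP dQ by (simp add: left_diff_distrib)
  finally have eq: "(\<integral>\<omega>. \<phi> (X \<omega>) \<partial>Q) - (\<integral>\<omega>. \<phi> (X \<omega>) \<partial>P) = (\<integral>x. (q x - p x) * \<phi> x \<partial>lborel)" .
  have int: "integrable lborel (\<lambda>x. \<bar>p x - q x\<bar>)"
    using dP dQ by (intro integrable_abs Bochner_Integration.integrable_diff) auto
  have "\<bar>\<integral>x. (q x - p x) * \<phi> x \<partial>lborel\<bar> \<le> (\<integral>x. \<bar>p x - q x\<bar> \<partial>lborel)"
  proof (rule order_trans[OF integral_abs_bound], rule integral_mono)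
    show "integrable lborel (\<lambda>x. \<bar>(q x - p x) * \<phi> x\<bar>)"
      using dP dQ by (intro integrable_abs) (simp add: left_diff_distrib)
    show "\<bar>(q x - p x) * \<phi> x\<bar> \<le> \<bar>p x - q x\<bar>" for x
      using \<phi>[of x] by (simp add: abs_mult abs_minus_commute mult_left_le)
  qed (fact int)
  also have "\<dots> \<le> 2 * sqrt d"
  proof -
    have "ennreal (\<integral>x. \<bar>p x - q x\<bar> \<partial>lborel) = (\<integral>\<^sup>+x. ennreal \<bar>p x - q x\<bar> \<partial>lborel)"
      by (rule nn_integral_eq_integral[symmetric, OF int]) simp
    also have "\<dots> \<le> ennreal (2 * sqrt d)"
      using dP dQ nonneg D by (intro nn_integral_abs_diff_le_rel_entropy) auto
    finally show ?thesis using D(2) by (subst (asm) ennreal_le_iff) auto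
  qed
  finally show ?thesis using eq by simp
qed

section \<open>Divergence\<close>

lemma eln_mono: "x \<le> y \<Longrightarrow> eln x \<le> eln y"
  by (cases x; cases y) (auto simp: eln_def)

text \<open>The supremum is attained at \<open>Q\<close>, so the two terms cancel. Positivity makes
  the logarithm finite: at likelihood 0 the sum would be
  \<open>\<infinity> + (-\<infinity>)\<close>, which is \<open>\<infinity>\<close> in
  \<open>ereal\<close>.\<close>

lemma divergence_maximizer:
  assumes "Q \<in> \<Q>" "\<And>Q'. Q' \<in> \<Q> \<Longrightarrow> likelihood f N x Q' \<le> likelihood f N x Q"
    and "0 < likelihood f N x Q"
  shows "divergence f \<Q> N x Q = 0"
proof -
  have "(SUP Q'\<in>\<Q>. eln (ereal (likelihood f N x Q'))) = eln (ereal (likelihood f N x Q))"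
    using assms by (intro SUP_eqI) (auto intro: eln_mono)
  then show ?thesis
    using assms(3) by (simp add: divergence_def eln_def zero_ereal_def)
qed

text \<open>A finite bound on the divergence excludes the case in which \<open>entropy_gap\<close>
  is 0 by convention, so the gap is a true absolute difference and the triangle inequality
  applies.\<close>

lemma rel_entropy_le_of_entropy_gap:
  assumes gap: "entropy_gap f \<Q> P N x Q \<le> ereal c"
    and div: "divergence f \<Q> N x Q \<le> ereal k" and "N \<ge> 1"
  shows "rel_entropy (f P) (f Q) \<le> ereal (k / real N + c)"
proof -
  define a where "a = divergence f \<Q> N x Q / ereal (real N)"
  have a: "a \<le> ereal (k / real N)"
    using div \<open>N \<ge> 1\<close> unfolding a_def
    by (cases "divergence f \<Q> N x Q") (auto simp: divide_right_mono)
  then have "\<bar>a - rel_entropy (f P) (f Q)\<bar> \<le> ereal c"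
    using gap by (auto simp: entropy_gap_def a_def[symmetric] Let_def split: if_splits)
  with a show ?thesis
    by (cases a; cases "rel_entropy (f P) (f Q)") auto
qed

text \<open>The penalty is 0 if the divergence is at most \<open>k\<close> and
  \<open>\<infinity>\<close> otherwise, so measures outside this confidence region contribute
  \<open>-\<infinity>\<close> to the supremum.\<close>

lemma DR_expectation_le:
  assumes "0 < k"
    and "\<And>Q. Q \<in> \<Q> \<Longrightarrow> divergence f \<Q> N x Q \<le> ereal k \<Longrightarrow> (\<integral>\<omega>. \<phi> (X \<omega>) \<partial>Q) \<le> b"
  shows "DR_expectation f \<Q> X N x k \<phi> \<le> ereal b"
  unfolding DR_expectation_def
proof (rule SUP_least)
  fix Q assume Q: "Q \<in> \<Q>"
  show "ereal (\<integral>\<omega>. \<phi> (X \<omega>) \<partial>Q) - pow_infty (ereal (1 / k) * divergence f \<Q> N x Q) \<le> ereal b"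
  proof (cases "ereal (1 / k) * divergence f \<Q> N x Q \<le> 1")
    case True
    then have "divergence f \<Q> N x Q \<le> ereal k"
      using \<open>0 < k\<close>
      by (cases "divergence f \<Q> N x Q") (auto simp: one_ereal_def field_simps)
    then show ?thesis using assms(2)[OF Q] True by (simp add: pow_infty_def)
  qed (simp add: pow_infty_def)
qed

section \<open>Consistency\<close>

definition uniform_error ::
    "('a measure \<Rightarrow> real \<Rightarrow> real) \<Rightarrow> 'a measure set \<Rightarrow> ('a \<Rightarrow> real) \<Rightarrow> 'a measure \<Rightarrow> nat \<Rightarrow>
     (nat \<Rightarrow> real) \<Rightarrow> real \<Rightarrow> ereal" where
  "uniform_error f \<Q> X P N x k = (SUP \<phi>\<in>{\<phi> \<in> borel_measurable borel. \<forall>y. \<bar>\<phi> y\<bar> \<le> 1}.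
      DR_expectation f \<Q> X N x k \<phi> - ereal (\<integral>\<omega>'. \<phi> (X \<omega>') \<partial>P))"

text \<open>This is the deterministic core, for one fixed sample: every \<open>Q\<close> that is not
  penalized has relative entropy at most \<open>d\<close> from \<open>P\<close>, and the
  Pinsker-type bound holds for all test functions at once.\<close>

lemma uniform_error_le:
  assumes model: "iid_model M \<Q> X Xs f" and P: "P \<in> \<Q>" and "0 < k" "N \<ge> 1"
    and gap: "\<And>Q. Q \<in> \<Q> \<Longrightarrow> entropy_gap f \<Q> P N x Q \<le> ereal c"
    and d: "k / real N + c \<le> d" "0 < d"
  shows "uniform_error f \<Q> X P N x k \<le> ereal (2 * sqrt d)"
  unfolding uniform_error_def
proof (rule SUP_least)
  fix \<phi> :: "real \<Rightarrow> real"
  assume "\<phi> \<in> {\<phi> \<in> borel_measurable borel. \<forall>y. \<bar>\<phi> y\<bar> \<le> 1}"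
  then have \<phi>: "\<phi> \<in> borel_measurable borel" "\<And>y. \<bar>\<phi> y\<bar> \<le> 1" by auto
  have mod: "prob_space Q" "distributed Q lborel X (\<lambda>x. ennreal (f Q x))" "\<And>x. 0 \<le> f Q x"
    if "Q \<in> \<Q>" for Q
  proof -
    have "\<forall>n. distributed Q lborel ((Xs(0 := X)) n) (\<lambda>x. ennreal (f Q x))"
      using model that by (simp add: iid_model_def)
    \<comment> \<open>Index 0 of the modified family is \<open>X\<close> itself.\<close>
    from spec[OF this, of 0] show "distributed Q lborel X (\<lambda>x. ennreal (f Q x))" by simp
  qed (use model that in \<open>auto simp: iid_model_def\<close>)
  have "DR_expectation f \<Q> X N x k \<phi> \<le> ereal ((\<integral>\<omega>. \<phi> (X \<omega>) \<partial>P) + 2 * sqrt d)"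
  proof (rule DR_expectation_le[OF \<open>0 < k\<close>])
    fix Q assume Q: "Q \<in> \<Q>" and div: "divergence f \<Q> N x Q \<le> ereal k"
    have "rel_entropy (f P) (f Q) \<le> ereal (k / real N + c)"
      by (rule rel_entropy_le_of_entropy_gap[OF gap[OF Q] div \<open>N \<ge> 1\<close>])
    also have "\<dots> \<le> ereal d" using d by simp
    finally have "\<bar>(\<integral>\<omega>. \<phi> (X \<omega>) \<partial>Q) - (\<integral>\<omega>. \<phi> (X \<omega>) \<partial>P)\<bar> \<le> 2 * sqrt d"
      using mod[OF P] mod[OF Q] d \<phi> by (intro expectation_diff_le_rel_entropy) auto
    then show "(\<integral>\<omega>. \<phi> (X \<omega>) \<partial>Q) \<le> (\<integral>\<omega>. \<phi> (X \<omega>) \<partial>P) + 2 * sqrt d" by linarith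
  qed
  then show "DR_expectation f \<Q> X N x k \<phi> - ereal (\<integral>\<omega>'. \<phi> (X \<omega>') \<partial>P) \<le> ereal (2 * sqrt d)"
    by (cases "DR_expectation f \<Q> X N x k \<phi>") auto
qed

text \<open>The law of each observation has density \<open>f P\<close> and so gives no mass to the
  zero set of \<open>f P\<close>; the likelihood has finitely many factors.\<close>

lemma AE_likelihood_pos:
  assumes model: "iid_model M \<Q> X Xs f" and P: "P \<in> \<Q>"
  shows "AE \<omega> in P. 0 < likelihood f N (\<lambda>n. Xs n \<omega>) P"
proof -
  have nonneg: "0 \<le> f P x" for x
    using model P by (simp add: iid_model_def)
  have "AE \<omega> in P. 0 < f P (Xs n \<omega>)" if "n \<in> {1..N}" for n
  proof -
    have "\<forall>n. distributed P lborel ((Xs(0 := X)) n) (\<lambda>x. ennreal (f P x))"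
      using model P by (simp add: iid_model_def)
    from spec[OF this, of n] that have dist: "distributed P lborel (Xs n) (\<lambda>x. ennreal (f P x))"
      by (auto split: if_splits)
    have [measurable]: "f P \<in> borel_measurable borel"
      using distributed_real_measurable[of lborel "f P" P "Xs n"] dist nonneg by simp
    have [measurable]: "Xs n \<in> borel_measurable P"
      using distributed_measurable[OF dist] by simp
    have "AE x in density lborel (\<lambda>x. ennreal (f P x)). 0 < f P x"
      by (subst AE_density) auto
    then have "AE x in distr P lborel (Xs n). 0 < f P x"
      by (simp only: distributed_distr_eq_density[OF dist])
    then show ?thesis
      by (subst (asm) AE_distr_iff) auto
  qed
  then have "AE \<omega> in P. \<forall>n\<in>{1..N}. 0 < f P (Xs n \<omega>)"
    by (intro AE_finite_allI) auto
  then show ?thesis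
    by eventually_elim (auto simp: likelihood_def intro!: prod_pos)
qed

lemma uniform_error_nonneg:
  assumes MLE: "MLE_exists M S \<Q> Xs f N" and P: "P \<in> \<Q>" and \<omega>: "\<omega> \<in> space M"
    and pos: "0 < likelihood f N (\<lambda>n. Xs n \<omega>) P"
  shows "0 \<le> uniform_error f \<Q> X P N (\<lambda>n. Xs n \<omega>) k"
proof -
  define x where "x = (\<lambda>n. Xs n \<omega>)"
  \<comment> \<open>\<open>MLE_exists\<close> speaks of the sample restricted to
    \<open>{1..N}\<close>, and the likelihood reads only these entries.\<close>
  have restr: "likelihood f N (\<lambda>n\<in>{1..N}. Xs n \<omega>) Q = likelihood f N x Q" for Q
    by (simp add: likelihood_def x_def)
  obtain Qhat where "\<forall>\<omega>\<in>space M. let x = (\<lambda>n\<in>{1..N}. Xs n \<omega>) in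
      Qhat x \<in> \<Q> \<and> (\<forall>Q\<in>\<Q>. likelihood f N x Q \<le> likelihood f N x (Qhat x))"
    using MLE unfolding MLE_exists_def by blast
  from bspec[OF this \<omega>]
  obtain Q where Q: "Q \<in> \<Q>" "\<And>Q'. Q' \<in> \<Q> \<Longrightarrow> likelihood f N x Q' \<le> likelihood f N x Q"
    unfolding Let_def restr by blast
  have "divergence f \<Q> N x Q = 0"
    using Q Q(2)[OF P] pos by (intro divergence_maximizer) (auto simp: x_def)
  then have "0 \<le> DR_expectation f \<Q> X N x k (\<lambda>_. 0)"
    unfolding DR_expectation_def using Q(1)
    by (intro SUP_upper2[of Q]) (auto simp: pow_infty_def zero_ereal_def)
  then show ?thesis
    unfolding uniform_error_def x_def[symmetric]
    by (intro SUP_upper2[of "\<lambda>_. 0"]) (auto simp: zero_ereal_def[symmetric])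
qed

section \<open>Stochastic convergence and the deterministic rate\<close>

lemma tendsto_0_in_probI:
  assumes "\<And>\<epsilon> \<eta>. 0 < \<epsilon> \<Longrightarrow> 0 < \<eta> \<Longrightarrow>
      \<forall>\<^sub>F N in sequentially. measure P {\<omega>\<in>space P. \<bar>Y N \<omega>\<bar> > ereal \<epsilon>} < \<eta>"
  shows "tendsto_0_in_prob P Y"
  unfolding tendsto_0_in_prob_def
proof (intro allI impI order_tendstoI)
  fix \<epsilon> \<eta> :: real assume "\<eta> < 0"
  then show "\<forall>\<^sub>F N in sequentially. \<eta> < measure P {\<omega>\<in>space P. \<bar>Y N \<omega>\<bar> > ereal \<epsilon>}"
    by (intro always_eventually allI) (erule less_le_trans[OF _ measure_nonneg])
qed (rule assms)

lemma bigO_in_probD: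
  assumes "bigO_in_prob P Y g" "0 < \<eta>"
  obtains C :: real where "0 < C"
    "\<forall>\<^sub>F N in sequentially. emeasure P {\<omega>\<in>space P. \<bar>Y N \<omega> / ereal (g N)\<bar> > ereal C} < ennreal \<eta>"
proof -
  have "\<forall>\<^sub>F C::real in at_top.
      limsup (\<lambda>N. emeasure P {\<omega>\<in>space P. \<bar>Y N \<omega> / ereal (g N)\<bar> > ereal C}) < ennreal \<eta> \<and> 0 < C"
    using assms unfolding bigO_in_prob_def
    by (intro eventually_conj order_tendstoD(2)[where y = 0] eventually_gt_at_top) auto
  then obtain C :: real where C: "0 < C"
      "limsup (\<lambda>N. emeasure P {\<omega>\<in>space P. \<bar>Y N \<omega> / ereal (g N)\<bar> > ereal C}) < ennreal \<eta>"
    by (metis (mono_tags, lifting) eventually_happens trivial_limit_at_top_linorder)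
  then show ?thesis using Limsup_lessD that by blast
qed

text \<open>This is where \<open>k N = o(N)\<close> enters: both the confidence radius per
  observation and the GCD fluctuation vanish.\<close>

lemma eventually_rate_le:
  fixes k :: "nat \<Rightarrow> real"
  assumes "k \<in> o(\<lambda>N. real N)" "0 < d"
  shows "\<forall>\<^sub>F N in sequentially. k N / real N + C * real N powr (-1/2) \<le> d"
proof -
  have "(\<lambda>N. k N / real N) \<longlonglongrightarrow> 0"
    using assms(1) by (rule smalloD_tendsto)
  moreover have "(\<lambda>N. real N powr (-1/2)) \<longlonglongrightarrow> 0"
    by (rule tendsto_neg_powr[OF _ filterlim_real_sequentially]) simp
  ultimately have "(\<lambda>N. k N / real N + C * real N powr (-1/2)) \<longlonglongrightarrow> 0 + C * 0"
    by (intro tendsto_intros)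
  then have "\<forall>\<^sub>F N in sequentially. k N / real N + C * real N powr (-1/2) < d"
    using assms(2) by (intro order_tendstoD(2)) simp_all
  then show ?thesis
    by eventually_elim simp
qed

theorem theorem3:
  fixes M :: "'a measure" and \<Q> :: "'a measure set" and S :: "'a measure measure"
    and X :: "'a \<Rightarrow> real" and Xs :: "nat \<Rightarrow> 'a \<Rightarrow> real"
    and f :: "'a measure \<Rightarrow> real \<Rightarrow> real" and k :: "nat \<Rightarrow> real" and P :: "'a measure"
  assumes model: "iid_model M \<Q> X Xs f"
    and S: "space S = \<Q>"
    and MLE: "\<And>N. N \<ge> 1 \<Longrightarrow> MLE_exists M S \<Q> Xs f N"
    and GCD: "GCD_class \<Q> Xs f"
    and k_pos: "\<And>N. N \<ge> 1 \<Longrightarrow> 0 < k N"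
    and k_small: "k \<in> o(\<lambda>N. real N)"
    and P: "P \<in> \<Q>"
  shows "tendsto_0_in_prob P (\<lambda>N. measurable_cover P (\<lambda>\<omega>.
      SUP \<phi>\<in>{\<phi> \<in> borel_measurable borel. \<forall>y. \<bar>\<phi> y\<bar> \<le> 1}.
        DR_expectation f \<Q> X N (\<lambda>n. Xs n \<omega>) (k N) \<phi> - ereal (\<integral>\<omega>'. \<phi> (X \<omega>') \<partial>P)))"
  unfolding uniform_error_def[symmetric]
proof -
  have "prob_space P" and sets_P: "sets P = sets M"
    using model P by (auto simp: iid_model_def)
  interpret prob_space P by fact
  have space_P: "space P = space M"
    by (rule sets_eq_imp_space_eq[OF sets_P])
  define G where "G N = measurable_cover P
    (\<lambda>\<omega>. SUP Q\<in>\<Q>. entropy_gap f \<Q> P N (\<lambda>n. Xs n \<omega>) Q)" for N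
  define g where "g N = real N powr (-1/2)" for N
  define err where "err N \<omega> = uniform_error f \<Q> X P N (\<lambda>n. Xs n \<omega>) (k N)" for N \<omega>
  define H where "H N = measurable_cover P (err N)" for N
  note G = is_measurable_cover_measurable_cover[OF \<open>prob_space P\<close>,
      of "\<lambda>\<omega>. SUP Q\<in>\<Q>. entropy_gap f \<Q> P N (\<lambda>n. Xs n \<omega>) Q" for N, folded G_def]
  note H = is_measurable_cover_measurable_cover[OF \<open>prob_space P\<close>, of "err N" for N, folded H_def]
  have [measurable]: "G N \<in> borel_measurable P" "H N \<in> borel_measurable P" for N
    using G H by (auto simp: is_measurable_cover_def)
  have "tendsto_0_in_prob P H"
  proof (rule tendsto_0_in_probI)
    fix \<epsilon> \<eta> :: real assume "0 < \<epsilon>" "0 < \<eta>"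
    \<comment> \<open>Chosen so that the bound \<open>2 * sqrt d\<close> equals
      \<open>\<epsilon>\<close>.\<close>
    define d where "d = (\<epsilon> / 2)\<^sup>2"
    have d: "0 < d" "2 * sqrt d = \<epsilon>" using \<open>0 < \<epsilon>\<close> by (auto simp: d_def)
    have "bigO_in_prob P G g"
      using GCD P unfolding GCD_class_def G_def g_def by blast
    then obtain C where "0 < C" and
      C: "\<forall>\<^sub>F N in sequentially. emeasure P {\<omega>\<in>space P. \<bar>G N \<omega> / ereal (g N)\<bar> > ereal C} < ennreal \<eta>"
      using \<open>0 < \<eta>\<close> by (rule bigO_in_probD)
    have "\<forall>\<^sub>F N in sequentially. k N / real N + C * g N \<le> d"
      using eventually_rate_le[OF k_small d(1)] by (simp add: g_def)
    with C eventually_ge_at_top[of 1]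
    show "\<forall>\<^sub>F N in sequentially. measure P {\<omega>\<in>space P. \<bar>H N \<omega>\<bar> > ereal \<epsilon>} < \<eta>"
    proof eventually_elim
      case (elim N)
      let ?B = "{\<omega>\<in>space P. \<bar>G N \<omega> / ereal (g N)\<bar> > ereal C}"
      \<comment> \<open>Here \<open>N \<ge> 1\<close> matters, since \<open>0 powr (-1/2)\<close> is
        0.\<close>
      have g: "0 < g N" using elim by (simp add: g_def)
      \<comment> \<open>The error itself may fail to be measurable. A measurable majorant, infinite
        on the bad event \<open>?B\<close>, allows the minimality of the cover \<open>H N\<close> to
        be used.\<close>
      have "err N \<omega> \<le> (if \<omega> \<in> ?B then \<infinity> else ereal \<epsilon>)" if "\<omega> \<in> space P" for \<omega>
      proof (cases "\<omega> \<in> ?B")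
        case False
        then have "\<bar>G N \<omega> / ereal (g N)\<bar> \<le> ereal C"
          using that by auto
        then have "G N \<omega> \<le> ereal (C * g N)"
          using g by (cases "G N \<omega>") (auto simp: field_simps)
        \<comment> \<open>The cover dominates at every point of the space, so off \<open>?B\<close>
          the bound holds for all \<open>Q\<close> simultaneously.\<close>
        moreover have "(SUP Q\<in>\<Q>. entropy_gap f \<Q> P N (\<lambda>n. Xs n \<omega>) Q) \<le> G N \<omega>"
          using G that by (auto simp: is_measurable_cover_def)
        ultimately have "entropy_gap f \<Q> P N (\<lambda>n. Xs n \<omega>) Q \<le> ereal (C * g N)" if "Q \<in> \<Q>" for Q
          using that by (meson SUP_upper order_trans)
        then have "err N \<omega> \<le> ereal (2 * sqrt d)"
          unfolding err_def using elim d k_pos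
          by (intro uniform_error_le[OF model P, where c = "C * g N"]) auto
        then show ?thesis using False d by simp
      qed simp
      then have upper: "AE \<omega> in P. H N \<omega> \<le> (if \<omega> \<in> ?B then \<infinity> else ereal \<epsilon>)"
        using H[of N] unfolding is_measurable_cover_def by auto
      \<comment> \<open>Convergence concerns the absolute value of \<open>H N\<close>, so large
        negative values have to be excluded as well.\<close>
      have "AE \<omega> in P. 0 \<le> err N \<omega>"
        using AE_likelihood_pos[OF model P, of N] AE_space unfolding err_def
        by eventually_elim (use MLE elim P space_P in \<open>auto intro!: uniform_error_nonneg\<close>)
      then have lower: "AE \<omega> in P. 0 \<le> H N \<omega>"
        using AE_space
        by eventually_elim (use H[of N] in \<open>auto simp: is_measurable_cover_def intro: order_trans\<close>)
      \<comment> \<open>Where \<open>H N\<close> is nonnegative and exceeds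
        \<open>\<epsilon>\<close>, its majorant must take the value
        \<open>\<infinity>\<close>.\<close>
      have "AE \<omega> in P. \<omega> \<in> {\<omega>\<in>space P. \<bar>H N \<omega>\<bar> > ereal \<epsilon>} \<longrightarrow> \<omega> \<in> ?B"
        using upper lower
        by eventually_elim (auto split: if_splits)
      then have "measure P {\<omega>\<in>space P. \<bar>H N \<omega>\<bar> > ereal \<epsilon>} \<le> measure P ?B"
        by (intro finite_measure_mono_AE) auto
      also have "\<dots> < \<eta>"
        using elim by (simp add: emeasure_eq_measure ennreal_less_iff)
      finally show ?case .
    qed
  qed
  then show "tendsto_0_in_prob P (\<lambda>N. measurable_cover P
      (\<lambda>\<omega>. uniform_error f \<Q> X P N (\<lambda>n. Xs n \<omega>) (k N)))"
    by (simp only: H_def[abs_def] err_def[abs_def])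
qed

end
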